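(* Let $(X,f)$ be a topological dynamical system. If $(X,f)$ has a semi-horseshoe, then for any non-trivial weight $\vartheta\in\ell^\infty(\mathbb N)$ we have $h_{\mathrm{top}}(f,\mathcal N_\vartheta(f,X))>0$.
   Context: A topological dynamical system $(X,f)$ consists of a compact metric space $(X,d)$ and a continuous map $f:X\to X$. For $N\ge1$, a subsystem $(\Lambda,f^N)$ of $(X,f^N)$ is a nonempty compact set $\Lambda\subset X$ with $f^N(\Lambda)\subset\Lambda$. Let $\sigma$ denote the left shift on $\{0,1\}^{\mathbb N}$ ($\mathbb N=\{0,1,2,\dots\}$) or on $\{0,1\}^{\mathbb Z}$. A subsystem $(\Lambda,f^N)$ is a one-sided (resp. two-sided) $N$-order semi-horseshoe of $(X,f)$ if there is a continuous surjection $\pi:\Lambda\to\{0,1\}^{\mathbb N}$ (resp. $\{0,1\}^{\mathbb Z}$) with $\pi\circ f^N=\sigma\circ\pi$. $(X,f)$ has a semi-horseshoe if it has a one-sided or two-sided $N$-order semi-horseshoe for some $N\ge 1$. A bounded real sequence $\vartheta=(\vartheta_n)_{n\ge 0}$ is a non-trivial weight if $\limsup_{N\to\infty}\frac1N\sum_{n=0}^{N-1}|\vartheta_n|>0$. $\mathcal N_\vartheta(f,X)$ is the set of $x\in X$ for which there is a continuous $\varphi:X\to\mathbb R$ with $\limsup_{N\to\infty}\frac1N\left|\sum_{n=0}^{N-1}\vartheta_n\varphi(f^nx)\right|>0$. Bowen topological entropy of a subset $E\subset X$: let $B_u(f;x,r)=\{z\in X: d(f^ix,f^iz)<r,\ 0\le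 i\le u-1\}$. For $t\ge0$ let $C(E;t,n,r,f)$ be the infimum of $\sum e^{-tu}$ over all finite or countable covers of $E$ by sets $B_u(f;x,r)$ with $u\ge n$; let $C(E;t,r,f)=\lim_{n\to\infty}C(E;t,n,r,f)$, $h_{\mathrm{top}}(E;r,f)=\inf\{t:C(E;t,r,f)=0\}$ and $h_{\mathrm{top}}(f,E)=\lim_{r\to0}h_{\mathrm{top}}(E;r,f)$. *)

theory Defs
  imports "HOL-Analysis.Analysis"
begin

(* The phase space is a compact subset X of a type of class metric_space, with the metric dist;
   only the restriction of f to X matters. *)
definition tds :: "'a::metric_space set \<Rightarrow> ('a \<Rightarrow> 'a) \<Rightarrow> bool" where
  "tds X f \<longleftrightarrow> compact X \<and> continuous_on X f \<and> f ` X \<subseteq> X"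

definition subsystem :: "'a::metric_space set \<Rightarrow> ('a \<Rightarrow> 'a) \<Rightarrow> 'a set \<Rightarrow> bool" where
  "subsystem X g \<Lambda> \<longleftrightarrow> \<Lambda> \<noteq> {} \<and> compact \<Lambda> \<and> \<Lambda> \<subseteq> X \<and> g ` \<Lambda> \<subseteq> \<Lambda>"

(* The full shifts on two symbols are the types nat => bool and int => bool; the library topology
   on a function type is the product topology, here of the discrete two-point space bool. *)
definition shift1 :: "(nat \<Rightarrow> bool) \<Rightarrow> (nat \<Rightarrow> bool)" where
  "shift1 s = (\<lambda>n. s (n + 1))"

definition shift2 :: "(int \<Rightarrow> bool) \<Rightarrow> (int \<Rightarrow> bool)" where
  "shift2 s = (\<lambda>n. s (n + 1))"

definition one_sided_semi_horseshoe ::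
    "'a::metric_space set \<Rightarrow> ('a \<Rightarrow> 'a) \<Rightarrow> nat \<Rightarrow> 'a set \<Rightarrow> bool" where
  "one_sided_semi_horseshoe X f N \<Lambda> \<longleftrightarrow>
     subsystem X (f ^^ N) \<Lambda> \<and>
     (\<exists>\<pi> :: 'a \<Rightarrow> (nat \<Rightarrow> bool). continuous_on \<Lambda> \<pi> \<and> \<pi> ` \<Lambda> = UNIV \<and>
        (\<forall>x\<in>\<Lambda>. \<pi> ((f ^^ N) x) = shift1 (\<pi> x)))"

definition two_sided_semi_horseshoe ::
    "'a::metric_space set \<Rightarrow> ('a \<Rightarrow> 'a) \<Rightarrow> nat \<Rightarrow> 'a set \<Rightarrow> bool" where
  "two_sided_semi_horseshoe X f N \<Lambda> \<longleftrightarrow>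
     subsystem X (f ^^ N) \<Lambda> \<and>
     (\<exists>\<pi> :: 'a \<Rightarrow> (int \<Rightarrow> bool). continuous_on \<Lambda> \<pi> \<and> \<pi> ` \<Lambda> = UNIV \<and>
        (\<forall>x\<in>\<Lambda>. \<pi> ((f ^^ N) x) = shift2 (\<pi> x)))"

definition has_semi_horseshoe :: "'a::metric_space set \<Rightarrow> ('a \<Rightarrow> 'a) \<Rightarrow> bool" where
  "has_semi_horseshoe X f \<longleftrightarrow>
     (\<exists>N\<ge>1. \<exists>\<Lambda>. one_sided_semi_horseshoe X f N \<Lambda> \<or> two_sided_semi_horseshoe X f N \<Lambda>)"

definition nontrivial_weight :: "(nat \<Rightarrow> real) \<Rightarrow> bool" where
  "nontrivial_weight \<theta> \<longleftrightarrow>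
     bounded (range \<theta>) \<and> limsup (\<lambda>N. ereal (1 / real N * (\<Sum>n<N. \<bar>\<theta> n\<bar>))) > 0"

definition weighted_set ::
    "(nat \<Rightarrow> real) \<Rightarrow> ('a::metric_space \<Rightarrow> 'a) \<Rightarrow> 'a set \<Rightarrow> 'a set" where
  "weighted_set \<theta> f X =
     {x \<in> X. \<exists>\<phi> :: 'a \<Rightarrow> real. continuous_on X \<phi> \<and>
        limsup (\<lambda>N. ereal (1 / real N * \<bar>\<Sum>n<N. \<theta> n * \<phi> ((f ^^ n) x)\<bar>)) > 0}"

definition bowen_ball ::
    "'a::metric_space set \<Rightarrow> ('a \<Rightarrow> 'a) \<Rightarrow> nat \<Rightarrow> 'a \<Rightarrow> real \<Rightarrow> 'a set" where
  "bowen_ball X f u x r = {z \<in> X. \<forall>i<u. dist ((f ^^ i) x) ((f ^^ i) z) < r}"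

(* A cover is a countable (possibly finite) set of pairs (x, u) standing for the balls
   bowen_ball X f u x r: the weight exp (- t u) depends on u and not on the ball as a mere set. *)
definition bowen_covers ::
    "'a::metric_space set \<Rightarrow> ('a \<Rightarrow> 'a) \<Rightarrow> 'a set \<Rightarrow> nat \<Rightarrow> real \<Rightarrow> ('a \<times> nat) set set" where
  "bowen_covers X f E n r =
     {F. countable F \<and> F \<subseteq> X \<times> {n..} \<and> E \<subseteq> (\<Union>(x, u)\<in>F. bowen_ball X f u x r)}"

definition bowen_C_n ::
    "'a::metric_space set \<Rightarrow> ('a \<Rightarrow> 'a) \<Rightarrow> 'a set \<Rightarrow> real \<Rightarrow> nat \<Rightarrow> real \<Rightarrow> ennreal" where
  "bowen_C_n X f E t n r =
     (INF F\<in>bowen_covers X f E n r. \<Sum>\<^sub>\<infinity>(x, u)\<in>F. ennreal (exp (- t * real u)))"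

definition bowen_C ::
    "'a::metric_space set \<Rightarrow> ('a \<Rightarrow> 'a) \<Rightarrow> 'a set \<Rightarrow> real \<Rightarrow> real \<Rightarrow> ennreal" where
  "bowen_C X f E t r = lim (\<lambda>n. bowen_C_n X f E t n r)"

definition htop_scale ::
    "'a::metric_space set \<Rightarrow> ('a \<Rightarrow> 'a) \<Rightarrow> 'a set \<Rightarrow> real \<Rightarrow> ereal" where
  "htop_scale X f E r = Inf {ereal t |t. t \<ge> 0 \<and> bowen_C X f E t r = 0}"

definition htop :: "'a::metric_space set \<Rightarrow> ('a \<Rightarrow> 'a) \<Rightarrow> 'a set \<Rightarrow> ereal" where
  "htop X f E = Lim (at_right 0) (htop_scale X f E)"

(* The two limits exist, by monotonicity, so the unspecified values of lim and Lim play no role. *)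

lemma bowen_C_n_mono: "m \<le> n \<Longrightarrow> bowen_C_n X f E t m r \<le> bowen_C_n X f E t n r"
  unfolding bowen_C_n_def by (rule INF_superset_mono) (auto simp: bowen_covers_def)

lemma bowen_C_n_tendsto: "(\<lambda>n. bowen_C_n X f E t n r) \<longlonglongrightarrow> bowen_C X f E t r"
proof -
  have "(\<lambda>n. bowen_C_n X f E t n r) \<longlonglongrightarrow> (SUP n. bowen_C_n X f E t n r)"
    by (rule LIMSEQ_SUP) (simp add: incseq_def bowen_C_n_mono)
  then show ?thesis
    unfolding bowen_C_def by (metis limI)
qed

lemma bowen_C_antimono:
  assumes "r \<le> s"
  shows "bowen_C X f E t s \<le> bowen_C X f E t r"
proof -
  have "bowen_ball X f u x r \<subseteq> bowen_ball X f u x s" for u x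
    using assms unfolding bowen_ball_def by (blast intro: less_le_trans)
  then have "bowen_covers X f E n r \<subseteq> bowen_covers X f E n s" for n
    unfolding bowen_covers_def by (simp add: Collect_mono_iff) blast
  then have "bowen_C_n X f E t n s \<le> bowen_C_n X f E t n r" for n
    unfolding bowen_C_n_def by (rule INF_superset_mono) simp
  then show ?thesis
    by (intro LIMSEQ_le[OF bowen_C_n_tendsto bowen_C_n_tendsto]) auto
qed

lemma htop_scale_antimono:
  assumes "r \<le> s"
  shows "htop_scale X f E s \<le> htop_scale X f E r"
  unfolding htop_scale_def
proof (rule Inf_superset_mono)
  show "{ereal t |t. t \<ge> 0 \<and> bowen_C X f E t r = 0} \<subseteq> {ereal t |t. t \<ge> 0 \<and> bowen_C X f E t s = 0}"
  proof clarify
    fix t :: real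
    assume "t \<ge> 0" "bowen_C X f E t r = 0"
    moreover have "bowen_C X f E t s \<le> bowen_C X f E t r"
      by (rule bowen_C_antimono[OF assms])
    ultimately show "\<exists>t'. ereal t = ereal t' \<and> 0 \<le> t' \<and> bowen_C X f E t' s = 0"
      by (intro exI[of _ t]) simp
  qed
qed

lemma htop_tendsto: "(htop_scale X f E \<longlongrightarrow> htop X f E) (at_right 0)"
proof -
  define S where "S = (SUP r\<in>{0<..}. htop_scale X f E r)"
  have "(htop_scale X f E \<longlongrightarrow> S) (at_right 0)"
  proof (rule order_tendstoI)
    fix a assume "a < S"
    then obtain s where s: "s > 0" "a < htop_scale X f E s"
      unfolding S_def by (auto simp: less_SUP_iff)
    show "\<forall>\<^sub>F r in at_right 0. a < htop_scale X f E r"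
      unfolding eventually_at_right_field
      using s htop_scale_antimono[of _ s X f E]
      by (meson less_imp_le order.strict_trans2)
  next
    fix a assume a: "S < a"
    show "\<forall>\<^sub>F r in at_right 0. htop_scale X f E r < a"
      using eventually_at_right_less[of "0::real"]
    proof eventually_elim
      case (elim r)
      then have "htop_scale X f E r \<le> S"
        unfolding S_def by (intro SUP_upper) auto
      then show ?case
        using a by order
    qed
  qed
  then show ?thesis
    unfolding htop_def by (metis tendsto_Lim trivial_limit_at_right_real)
qed

end

(* The difficulty is that the images f^i(Lambda), 0 < i < K, of a horseshoe of order K may meet
   Lambda, so that the weights in different residue classes modulo K may cancel. One first passes
   to a horseshoe Gamma whose images f^i(Gamma), 0 < i < K, are disjoint from Gamma. Consider for
   each point z the set of phases i with z in f^i(Lambda). If the points of Lambda with a given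
   phase set of maximal size still realise all symbol sequences, then they form such a Gamma;
   otherwise each of these finitely many sets misses a word, and the sub-horseshoe coded by
   self-synchronising blocks that contain all the missing words has smaller phase sets.

   On Gamma a continuous function can be chosen that is the first symbol on Gamma and 0 on the
   other f^i(Gamma). It only sees one residue class of times, so the symbols may follow the sign of
   the weight there, except for a sparse set of free symbols. The free symbols can be read off from
   the orbit at fixed resolution, which bounds the Bowen entropy from below. *)

theory Submission
  imports Defs
begin

section \<open>Lower bounds for the Bowen entropy\<close>

lemma compact_UNIV_bool_seq: "compact (UNIV :: (nat \<Rightarrow> bool) set)"
proof -
  have "compact_space (euclidean :: bool topology)"
    by (simp add: compact_space_def finite_imp_compact)
  then have "compact_space (product_topology (\<lambda>_::nat. euclidean :: bool topology) UNIV)"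
    by (simp add: compact_space_product_topology)
  then show ?thesis
    by (simp add: euclidean_product_topology compact_space_def)
qed

lemma open_cylinder: "open {e :: nat \<Rightarrow> bool. \<forall>m<k. e m = v m}"
proof -
  have "open {e. e m = v m}" for m
  proof -
    have "open ((\<lambda>e :: nat \<Rightarrow> bool. e m) -` {v m})"
      by (rule open_vimage) (auto intro: continuous_on_product_coordinates discrete_topology_class.open_discrete)
    then show ?thesis
      by (simp add: vimage_def)
  qed
  then have "open (\<Inter>m\<in>{..<k}. {e. e m = v m})"
    by (intro open_INT) auto
  moreover have "(\<Inter>m\<in>{..<k}. {e. e m = v m}) = {e. \<forall>m<k. e m = v m}"
    by auto
  ultimately show ?thesis
    by simp
qed

text \<open>The uniform measure of the cylinders, computed by counting. Every word of the maximal
  length \<open>L\<close> extends the prefix of some \<open>p\<close>, and a prefix of length k has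
  2^(L-k) extensions.\<close>

lemma cylinder_cover_finite:
  fixes len :: "'b \<Rightarrow> nat" and v :: "'b \<Rightarrow> nat \<Rightarrow> bool"
  assumes "finite F" and cover: "\<And>e. \<exists>p\<in>F. \<forall>m<len p. e m = v p m"
  shows "(\<Sum>p\<in>F. (1/2::real) ^ len p) \<ge> 1"
proof -
  obtain L where L: "\<And>p. p \<in> F \<Longrightarrow> len p \<le> L"
    using \<open>finite F\<close> by (meson finite_imageI finite_nat_set_iff_bounded_le image_eqI)
  \<comment> \<open>A word of length \<open>L\<close> is encoded as the set of positions at which it
    is true.\<close>
  define W where "W p = {b \<in> Pow {..<L}. \<forall>m<len p. (m \<in> b) = v p m}" for p
  have card_W: "card (W p) \<le> 2 ^ (L - len p)" for p
  proof -
    have "inj_on (\<lambda>b. b - {..<len p}) (W p)"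
    proof (rule inj_onI)
      fix b b' assume "b \<in> W p" "b' \<in> W p" "b - {..<len p} = b' - {..<len p}"
      then have "m \<in> b \<longleftrightarrow> m \<in> b'" for m
        by (cases "m < len p") (auto simp: W_def set_eq_iff)
      then show "b = b'"
        by blast
    qed
    moreover have "(\<lambda>b. b - {..<len p}) ` W p \<subseteq> Pow ({..<L} - {..<len p})"
      by (auto simp: W_def)
    ultimately have "card (W p) \<le> card (Pow ({..<L} - {..<len p}))"
      by (meson card_inj_on_le finite_Diff finite_Pow_iff finite_lessThan)
    also have "\<dots> = 2 ^ (L - len p)"
      by (simp add: card_Pow lessThan_minus_lessThan)
    finally show ?thesis .
  qed
  have "Pow {..<L} \<subseteq> (\<Union>p\<in>F. W p)"
  proof
    fix b assume "b \<in> Pow {..<L}"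
    then show "b \<in> (\<Union>p\<in>F. W p)"
      using cover[of "\<lambda>m. m \<in> b"] by (auto simp: W_def)
  qed
  then have "card (Pow {..<L}) \<le> card (\<Union>p\<in>F. W p)"
    using \<open>finite F\<close> by (intro card_mono) (auto simp: W_def)
  also have "\<dots> \<le> (\<Sum>p\<in>F. card (W p))"
    using \<open>finite F\<close> by (rule card_UN_le)
  also have "\<dots> \<le> (\<Sum>p\<in>F. 2 ^ (L - len p))"
    by (intro sum_mono card_W)
  finally have "2 ^ L \<le> (\<Sum>p\<in>F. 2 ^ (L - len p) :: nat)"
    by (simp add: card_Pow)
  then have "real (2 ^ L) \<le> real (\<Sum>p\<in>F. 2 ^ (L - len p))"
    by (rule of_nat_mono)
  then have "(2::real) ^ L \<le> (\<Sum>p\<in>F. 2 ^ (L - len p))"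
    by simp
  also have "\<dots> = (\<Sum>p\<in>F. 2 ^ L * (1/2) ^ len p)"
    by (intro sum.cong refl) (simp add: L power_diff power_divide)
  finally show ?thesis
    by (simp add: flip: sum_distrib_left)
qed

lemma cylinder_cover:
  fixes len :: "'b \<Rightarrow> nat" and v :: "'b \<Rightarrow> nat \<Rightarrow> bool"
  assumes cover: "\<And>e. \<exists>p\<in>F. \<forall>m<len p. e m = v p m"
  obtains F' where "finite F'" "F' \<subseteq> F" "(\<Sum>p\<in>F'. (1/2::real) ^ len p) \<ge> 1"
proof -
  let ?C = "\<lambda>p. {e. \<forall>m<len p. e m = v p m}"
  have "UNIV \<subseteq> (\<Union>p\<in>F. ?C p)"
    using cover by auto
  then obtain F' where F': "F' \<subseteq> F" "finite F'" "UNIV \<subseteq> (\<Union>p\<in>F'. ?C p)"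
    by (rule compactE_image[OF compact_UNIV_bool_seq open_cylinder])
  have "\<exists>p\<in>F'. \<forall>m<len p. e m = v p m" for e
    using subsetD[OF F'(3), of e] by auto
  from that[OF F'(2,1) cylinder_cover_finite[OF F'(2) this]] show ?thesis .
qed

text \<open>Two coded points in one Bowen ball of length u and radius \<open>r\<close> carry the
  same bits at all m with \<open>L * m + d\<close> < u. The ball thus meets the coded points inside
  a cylinder of length about u / L, and counting cylinders gives entropy at least ln 2 / L already
  at scale \<open>r\<close>.\<close>

lemma htop_pos_if_coding:
  fixes f :: "'a::metric_space \<Rightarrow> 'a" and y :: "(nat \<Rightarrow> bool) \<Rightarrow> 'a"
  assumes y: "\<And>e. y e \<in> E" and "r > 0" and "L > 0"
    and sep: "\<And>e e' m. e m \<noteq> e' m \<Longrightarrow>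
      2 * r \<le> dist ((f ^^ (L * m + d)) (y e)) ((f ^^ (L * m + d)) (y e'))"
  shows "htop X f E > 0"
proof -
  \<comment> \<open>With this \<open>t\<close> one bit costs a factor 1/2 per \<open>L\<close> time
    steps. The number \<open>len p\<close> is a lower bound for the bits visible in the ball
    \<open>p\<close>; truncated subtraction makes it 0 for short balls. The factor \<open>c\<close>
    pays for the at most \<open>d + 1\<close> bits lost by this rounding.\<close>
  define t where "t = ln 2 / real L"
  define c where "c = (1/2::real) ^ (d + 1)"
  define len where "len p = snd p div L - d" for p :: "'a \<times> nat"
  have "t > 0" "c > 0"
    using \<open>L > 0\<close> by (auto simp: t_def c_def)
  have weight: "c * (1/2) ^ len p \<le> exp (- t * real (snd p))" for p
  proof -
    have "snd p < L * (snd p div L + 1)"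
      using \<open>L > 0\<close> by (metis Suc_eq_plus1 dividend_less_times_div mult_Suc_right)
    also have "\<dots> \<le> L * (len p + d + 1)"
      by (intro mult_left_mono) (auto simp: len_def)
    finally have "real (snd p) \<le> real L * real (len p + d + 1)"
      by (metis of_nat_le_iff of_nat_mult less_imp_le)
    then have "t * real (snd p) \<le> t * (real L * real (len p + d + 1))"
      using \<open>t > 0\<close> by simp
    also have "\<dots> = real (len p + d + 1) * ln 2"
      using \<open>L > 0\<close> by (simp add: t_def)
    finally have "exp (- (real (len p + d + 1) * ln 2)) \<le> exp (- t * real (snd p))"
      by simp
    moreover have "exp (- (real (len p + d + 1) * ln 2)) = c * (1/2) ^ len p"
      unfolding exp_minus exp_of_nat_mult by (simp add: c_def power_add power_one_over field_simps)
    ultimately show ?thesis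
      by argo
  qed
  have lower: "ennreal c \<le> bowen_C_n X f E t' n r" if "t' \<le> t" for t' n
    unfolding bowen_C_n_def
  proof (rule INF_greatest)
    fix F assume F: "F \<in> bowen_covers X f E n r"
    define B where "B p = bowen_ball X f (snd p) (fst p) r" for p
    have "E \<subseteq> (\<Union>p\<in>F. B p)"
      using F by (simp add: bowen_covers_def B_def case_prod_unfold)
    then have B_cover: "\<exists>p\<in>F. y e \<in> B p" for e
      using y[of e] by blast
    \<comment> \<open>Any coded point of the ball determines the cylinder. Balls without coded
      points get an arbitrary one, which cannot spoil the cover.\<close>
    define v where "v p = (SOME e. y e \<in> B p)" for p
    have v: "\<exists>p\<in>F. \<forall>m<len p. e m = v p m" for e
    proof -
      obtain p where p: "p \<in> F" "y e \<in> B p"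
        using B_cover by blast
      then have p': "y (v p) \<in> B p"
        unfolding v_def by (metis someI)
      have "e m = v p m" if "m < len p" for m
      proof (rule ccontr)
        assume ne: "e m \<noteq> v p m"
        define i where "i = L * m + d"
        have "m + d + 1 \<le> snd p div L"
          using that by (auto simp: len_def)
        then have "L * (m + d + 1) \<le> snd p"
          using \<open>L > 0\<close> by (metis mult.commute less_eq_div_iff_mult_less_eq)
        moreover have "i < L * (m + d + 1)"
        proof -
          have "d < L * (d + 1)"
            using mult_le_mono1[of 1 L "d + 1"] \<open>L > 0\<close> by simp
          then show ?thesis
            by (simp add: i_def algebra_simps)
        qed
        ultimately have "i < snd p"
          by simp
        then have "dist ((f ^^ i) (fst p)) ((f ^^ i) (y e)) < r"
          "dist ((f ^^ i) (fst p)) ((f ^^ i) (y (v p))) < r"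
          using p p' by (auto simp: B_def bowen_ball_def)
        then have "dist ((f ^^ i) (y e)) ((f ^^ i) (y (v p))) < 2 * r"
          by metric
        with sep[of e m "v p"] ne show False
          by (simp add: i_def)
      qed
      with p show ?thesis
        by blast
    qed
    obtain F' where F': "finite F'" "F' \<subseteq> F" "(\<Sum>p\<in>F'. (1/2::real) ^ len p) \<ge> 1"
      using cylinder_cover[of F len v] v by blast
    have "c \<le> c * (\<Sum>p\<in>F'. (1/2) ^ len p)"
      using F'(3) \<open>c > 0\<close> by simp
    also have "\<dots> \<le> (\<Sum>p\<in>F'. exp (- t * real (snd p)))"
      unfolding sum_distrib_left by (intro sum_mono weight)
    also have "\<dots> \<le> (\<Sum>p\<in>F'. exp (- t' * real (snd p)))"
      using that by (intro sum_mono) (auto intro: mult_right_mono)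
    finally have "ennreal c \<le> ennreal (\<Sum>p\<in>F'. exp (- t' * real (snd p)))"
      by (rule ennreal_leI)
    also have "\<dots> = (\<Sum>(x, u)\<in>F'. ennreal (exp (- t' * real u)))"
      by (simp add: case_prod_unfold)
    also have "\<dots> = (\<Sum>\<^sub>\<infinity>(x, u)\<in>F'. ennreal (exp (- t' * real u)))"
      using F'(1) by simp
    also have "\<dots> \<le> (\<Sum>\<^sub>\<infinity>(x, u)\<in>F. ennreal (exp (- t' * real u)))"
      using F'(2) by (intro infsum_mono_neutral nonneg_summable_on_complete) auto
    finally show "ennreal c \<le> (\<Sum>\<^sub>\<infinity>(x, u)\<in>F. ennreal (exp (- t' * real u)))" .
  qed
  have "ereal t \<le> htop_scale X f E r"
    unfolding htop_scale_def
  proof (rule Inf_greatest, clarify)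
    fix t' :: real assume t': "bowen_C X f E t' r = 0"
    show "ereal t \<le> ereal t'"
    proof (rule ccontr)
      assume "\<not> ereal t \<le> ereal t'"
      then have "ennreal c \<le> bowen_C X f E t' r"
        by (intro LIMSEQ_le_const[OF bowen_C_n_tendsto] exI allI impI lower) simp
      with t' \<open>c > 0\<close> show False
        by simp
    qed
  qed
  moreover have "htop_scale X f E r \<le> htop X f E"
  proof (rule tendsto_lowerbound[OF htop_tendsto])
    show "\<forall>\<^sub>F s in at_right 0. htop_scale X f E r \<le> htop_scale X f E s"
      unfolding eventually_at_right_field
      using \<open>r > 0\<close> htop_scale_antimono by (metis less_imp_le)
  qed simp
  ultimately show ?thesis
    using \<open>t > 0\<close> by (metis ereal_less(2) order_less_le_trans)
qed

section \<open>Self-synchronising block codes\<close>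

lemma cylinder_subset_open:
  fixes U :: "(nat \<Rightarrow> bool) set"
  assumes "open U" "s \<in> U"
  obtains k where "{e. \<forall>m<k. e m = s m} \<subseteq> U"
proof -
  have "openin (product_topology (\<lambda>_. euclidean) UNIV) U"
    using \<open>open U\<close> by (simp add: euclidean_product_topology)
  then have "\<exists>V. finite {i \<in> UNIV. V i \<noteq> topspace (euclidean :: bool topology)} \<and>
      (\<forall>i\<in>UNIV. openin euclidean (V i)) \<and> s \<in> Pi\<^sub>E UNIV V \<and> Pi\<^sub>E UNIV V \<subseteq> U"
    using \<open>s \<in> U\<close> unfolding openin_product_topology_alt by (rule bspec)
  then obtain V where V: "finite {i. V i \<noteq> (UNIV :: bool set)}" "s \<in> Pi\<^sub>E UNIV V" "Pi\<^sub>E UNIV V \<subseteq> U"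
    by auto
  obtain k where k: "\<And>i. V i \<noteq> UNIV \<Longrightarrow> i < k"
    using V(1) unfolding finite_nat_set_iff_bounded by auto
  have "{e. \<forall>m<k. e m = s m} \<subseteq> U"
  proof
    fix e assume "e \<in> {e. \<forall>m<k. e m = s m}"
    then have "e m \<in> V m" for m
      using V(2) k[of m] by (cases "V m = UNIV") (simp_all add: PiE_iff)
    then have "e \<in> Pi\<^sub>E UNIV V"
      by (simp add: PiE_iff)
    with V(3) show "e \<in> U" ..
  qed
  then show ?thesis
    by (rule that)
qed

definition occurs :: "bool list \<Rightarrow> (nat \<Rightarrow> bool) \<Rightarrow> bool" where
  "occurs w s \<longleftrightarrow> (\<exists>a. \<forall>i<length w. s (i + a) = w ! i)"

lemma occurs_append:
  assumes "occurs (u @ v) s"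
  shows "occurs u s" "occurs v s"
proof -
  obtain a where a: "\<And>i. i < length u + length v \<Longrightarrow> s (i + a) = (u @ v) ! i"
    using assms by (auto simp: occurs_def)
  have "s (i + a) = u ! i" if "i < length u" for i
    using a[of i] that by (simp add: nth_append)
  then show "occurs u s"
    unfolding occurs_def by blast
  have "s (i + (length u + a)) = v ! i" if "i < length v" for i
    using a[of "length u + i"] that by (simp add: nth_append algebra_simps)
  then show "occurs v s"
    unfolding occurs_def by blast
qed

text \<open>A cylinder in the complement of \<open>S\<close> provides the word: an occurrence of it
  in a point of \<open>S\<close> could be shifted to the origin without leaving
  \<open>S\<close>.\<close>

lemma missing_word:
  assumes "closed S" "S \<noteq> UNIV" "shift1 ` S \<subseteq> S"
  shows "\<exists>w. \<forall>s\<in>S. \<not> occurs w s"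
proof -
  obtain s0 where s0: "s0 \<in> - S"
    using \<open>S \<noteq> UNIV\<close> by blast
  obtain k where k: "{e. \<forall>m<k. e m = s0 m} \<subseteq> - S"
    using \<open>closed S\<close> s0 by (rule cylinder_subset_open[OF open_Compl])
  have inv: "(\<lambda>n. s (n + m)) \<in> S" if "s \<in> S" for s m
  proof (induction m)
    case (Suc m)
    then have "shift1 (\<lambda>n. s (n + m)) \<in> S"
      using assms(3) by blast
    then show ?case
      by (simp add: shift1_def)
  qed (simp add: that)
  have "\<not> occurs (map s0 [0..<k]) s" if "s \<in> S" for s
  proof
    assume "occurs (map s0 [0..<k]) s"
    then obtain a where "\<forall>i<k. s (i + a) = s0 i"
      by (auto simp: occurs_def)
    then have "(\<lambda>n. s (n + a)) \<in> {e. \<forall>m<k. e m = s0 m}"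
      by simp
    then have "(\<lambda>n. s (n + a)) \<in> - S"
      using k by (rule rev_subsetD)
    with inv[OF that] show False
      by simp
  qed
  then show ?thesis
    by blast
qed

text \<open>The concatenation of words missed by the single members is missed by all of
  them.\<close>

lemma missing_word_family:
  assumes "finite \<S>"
    and "\<forall>S\<in>\<S>. closed S \<and> S \<noteq> UNIV \<and> shift1 ` S \<subseteq> S"
  shows "\<exists>w. \<forall>S\<in>\<S>. \<forall>s\<in>S. \<not> occurs w s"
  using assms
proof (induction rule: finite_induct)
  case (insert S \<S>)
  then obtain w where w: "\<forall>S\<in>\<S>. \<forall>s\<in>S. \<not> occurs w s"
    by auto
  obtain u where u: "\<forall>s\<in>S. \<not> occurs u s"
    using missing_word[of S] insert.prems by auto
  have "\<not> occurs (u @ w) s" if "s \<in> T" "T \<in> insert S \<S>" for T s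
    using u w that occurs_append[of u w s] by blast
  then have "\<forall>S\<in>insert S \<S>. \<forall>s\<in>S. \<not> occurs (u @ w) s"
    by blast
  then show ?case ..
qed auto

text \<open>Blocks of length \<open>l\<close> start at multiples of \<open>l\<close> and agree with
  the template \<open>t\<close> except for one data bit at position \<open>p\<close>. Reading the
  data bits turns the shift by \<open>l\<close> into a full shift.\<close>

definition block_shift :: "nat \<Rightarrow> nat \<Rightarrow> (nat \<Rightarrow> bool) \<Rightarrow> (nat \<Rightarrow> bool) set" where
  "block_shift l p t = {s. \<forall>n. n mod l \<noteq> p \<longrightarrow> s n = t (n mod l)}"

text \<open>Supplies the codes for sub-horseshoes: \<open>w\<close> is a word to be forced into
  every code, \<open>q\<close> prescribes a divisor of the block length, and the last clause lets
  the position inside a block be read off from any tail.\<close>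

lemma block_shift_exists:
  assumes "q > 0"
  shows "\<exists>l p t. q dvd l \<and> l > 0 \<and> p < l \<and>
    (\<forall>s\<in>block_shift l p t. occurs w s) \<and>
    (\<forall>s\<in>block_shift l p t. \<forall>s'\<in>block_shift l p t. \<forall>a b.
      (\<forall>n. s (n + a) = s' (n + b)) \<longrightarrow> a mod l = b mod l)"
proof -
  \<comment> \<open>The block is 0 1...1 0 w 0 d 0...0 with a run of L ones longer than w, so that the
    run can only occur at position 1 of a block; d is the data bit, at position p.\<close>
  define m L p l where "m = length w" and "L = length w + 2" and "p = L + 3 + m"
    and "l = q * (p + 2)"
  define t where "t i = (if 1 \<le> i \<and> i \<le> L then True
    else if L + 2 \<le> i \<and> i < L + 2 + m then w ! (i - (L + 2)) else False)" for i
  have "1 * (p + 2) \<le> l"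
    unfolding l_def using \<open>q > 0\<close> by (intro mult_le_mono1) simp
  then have l: "q dvd l" "l > 0" "p + 1 < l"
    by (auto simp: l_def)
  have t0: "\<not> t i" if "i = 0 \<or> i = L + 1 \<or> i = L + 2 + m \<or> i > p" for i
    using that by (auto simp: t_def p_def)
  have t1: "t (i + 1)" if "i < L" for i
    using that by (simp add: t_def)
  have word: "occurs w s" if s: "s \<in> block_shift l p t" for s
  proof -
    have "s (i + (L + 2)) = w ! i" if "i < length w" for i
    proof -
      have "i + (L + 2) < p"
        using that by (simp add: p_def m_def)
      then have "s (i + (L + 2)) = t (i + (L + 2))"
        using s l(3) by (simp add: block_shift_def)
      then show ?thesis
        using that by (simp add: t_def m_def)
    qed
    then show ?thesis
      unfolding occurs_def by blast
  qed
  have run: "n mod l = 1" if s: "s \<in> block_shift l p t" and ones: "\<And>i. i < L \<Longrightarrow> s (i + n)" for s n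
  proof (rule ccontr)
    define c where "c = n mod l"
    have "c < l"
      using l by (simp add: c_def)
    assume "n mod l \<noteq> 1"
    then consider "c = 0" | "2 \<le> c" "c \<le> L + 1" | "L + 2 \<le> c" "c \<le> L + 2 + m" | "c = p" | "p < c"
      by (fastforce simp: c_def p_def)
    \<comment> \<open>A window of length \<open>L\<close> that starts at a position \<open>c\<close>
      other than 1 meets a fixed zero of the same block: the one at 0, the one after the run, the
      one after \<open>w\<close>, the one after the data bit, or the padding.\<close>
    then have "\<exists>c'. c' < l \<and> c' \<noteq> p \<and> \<not> t c' \<and> c \<le> c' \<and> c' < c + L"
    proof cases
      case 1
      then show ?thesis using t0[of 0] \<open>c < l\<close> by (intro exI[of _ 0]) (auto simp: p_def L_def)
    next
      case 2
      then show ?thesis using t0[of "L + 1"] l(3) by (intro exI[of _ "L + 1"]) (auto simp: p_def)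
    next
      case 3
      then show ?thesis using t0[of "L + 2 + m"] l(3)
        by (intro exI[of _ "L + 2 + m"]) (auto simp: p_def L_def m_def)
    next
      case 4
      then show ?thesis using t0[of "p + 1"] l(3) by (intro exI[of _ "p + 1"]) (auto simp: L_def)
    next
      case 5
      then show ?thesis using t0[of c] \<open>c < l\<close> by (intro exI[of _ c]) (auto simp: L_def)
    qed
    then obtain c' where c': "c' < l" "c' \<noteq> p" "\<not> t c'" "c \<le> c'" "c' < c + L"
      by blast
    have "(c' - c + n) mod l = (c' - c + c) mod l"
      unfolding c_def by (rule mod_add_right_eq[symmetric])
    also have "\<dots> = c'"
      using c' by simp
    finally have "\<not> s (c' - c + n)"
      using s c' by (auto simp: block_shift_def)
    with ones[of "c' - c"] c' show False
      by auto
  qed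
  have recog: "a mod l = b mod l"
    if s: "s \<in> block_shift l p t" "s' \<in> block_shift l p t" and eq: "\<And>n. s (n + a) = s' (n + b)"
    for s s' a b
  proof -
    \<comment> \<open>This moves \<open>a\<close> to position 1 of the next block, where
      \<open>s\<close> has its run of ones. The run appears in \<open>s'\<close> as well, and by
      \<open>run\<close> it can only start at position 1 there.\<close>
    define n where "n = l - a mod l + 1"
    have na: "(n + a) mod l = 1"
    proof -
      have "(n + a) mod l = (n + a mod l) mod l"
        by (rule mod_add_right_eq[symmetric])
      also have "n + a mod l = l + 1"
        using l(2) by (simp add: n_def less_imp_le)
      finally show ?thesis
        using l(3) by (simp add: mod_Suc)
    qed
    have "s (i + (n + a))" if "i < L" for i
    proof -
      have "(i + (n + a)) mod l = (i + 1) mod l"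
        using na by (metis mod_add_right_eq)
      also have "\<dots> = i + 1"
        using that l(3) by (simp add: p_def)
      finally show ?thesis
        using s(1) t1[OF that] that by (auto simp: block_shift_def p_def)
    qed
    then have "s' (i + (n + b))" if "i < L" for i
      using that eq[of "i + n"] by (simp add: add.assoc)
    from run[OF s(2) this] have "(n + a) mod l = (n + b) mod l"
      using na by simp
    then show ?thesis
      unfolding nat_mod_eq_iff by (metis add.assoc add_left_cancel)
  qed
  have "p < l"
    using l(3) by simp
  show ?thesis
  proof (intro exI conjI ballI allI impI)
    show "occurs w s" if "s \<in> block_shift l p t" for s
      by (rule word[OF that])
    show "a mod l = b mod l"
      if "s \<in> block_shift l p t" "s' \<in> block_shift l p t" "\<forall>n. s (n + a) = s' (n + b)" for s s' a b
      by (rule recog[OF that(1,2) that(3)[rule_format]])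
  qed (fact l(1) l(2) \<open>p < l\<close>)+
qed

lemma closed_block_shift: "closed (block_shift l p t)"
proof -
  have "closed {s :: nat \<Rightarrow> bool. s n = c}" for n c
  proof -
    have "closed ((\<lambda>s :: nat \<Rightarrow> bool. s n) -` {c})"
      by (rule closed_vimage) (auto intro: continuous_on_product_coordinates)
    then show ?thesis
      by (simp add: vimage_def)
  qed
  then have "closed (\<Inter>n\<in>{n. n mod l \<noteq> p}. {s :: nat \<Rightarrow> bool. s n = t (n mod l)})"
    by (intro closed_INT) auto
  moreover have "(\<Inter>n\<in>{n. n mod l \<noteq> p}. {s :: nat \<Rightarrow> bool. s n = t (n mod l)}) = block_shift l p t"
    by (auto simp: block_shift_def)
  ultimately show ?thesis
    by simp
qed

lemma block_shift_shift:
  assumes "s \<in> block_shift l p t"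
  shows "(\<lambda>n. s (n + l)) \<in> block_shift l p t"
  unfolding block_shift_def mem_Collect_eq
proof (intro allI impI)
  fix n assume "n mod l \<noteq> p"
  then have "(n + l) mod l \<noteq> p"
    by simp
  then have "s (n + l) = t ((n + l) mod l)"
    using assms unfolding block_shift_def by blast
  then show "s (n + l) = t (n mod l)"
    by simp
qed

section \<open>Horseshoes with disjoint iterates\<close>

lemma compact_imp_closed_bool_seq:
  fixes S :: "(nat \<Rightarrow> bool) set"
  assumes "compact S"
  shows "closed S"
proof -
  have "discrete_topology UNIV = (euclidean :: bool topology)"
    unfolding discrete_topology_unique by (auto intro: open_discrete)
  then have "Hausdorff_space (euclidean :: bool topology)"
    by (metis Hausdorff_space_discrete_topology)
  then have "Hausdorff_space (product_topology (\<lambda>_::nat. euclidean :: bool topology) UNIV)"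
    unfolding Hausdorff_space_product_topology by blast
  then have "Hausdorff_space (euclidean :: (nat \<Rightarrow> bool) topology)"
    unfolding euclidean_product_topology .
  moreover have "compactin euclidean S"
    unfolding compactin_euclidean_iff by (fact assms)
  ultimately have "closedin euclidean S"
    by (rule compactin_imp_closedin)
  then show ?thesis
    unfolding closed_closedin .
qed

text \<open>The common form of both kinds of semi-horseshoe, with the factor map as a parameter
  because the recodings change it.\<close>

definition horseshoe ::
    "'a::metric_space set \<Rightarrow> ('a \<Rightarrow> 'a) \<Rightarrow> nat \<Rightarrow> 'a set \<Rightarrow> ('a \<Rightarrow> nat \<Rightarrow> bool) \<Rightarrow> bool" where
  "horseshoe X f K \<Lambda> \<pi> \<longleftrightarrow> K > 0 \<and> subsystem X (f ^^ K) \<Lambda> \<and> continuous_on \<Lambda> \<pi> \<and>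
     \<pi> ` \<Lambda> = UNIV \<and> (\<forall>x\<in>\<Lambda>. \<pi> ((f ^^ K) x) = shift1 (\<pi> x))"

lemma horseshoeD:
  assumes "horseshoe X f K \<Lambda> \<pi>"
  shows "K > 0" "compact \<Lambda>" "\<Lambda> \<subseteq> X" "continuous_on \<Lambda> \<pi>" "\<pi> ` \<Lambda> = UNIV"
    and "\<And>x. x \<in> \<Lambda> \<Longrightarrow> (f ^^ K) x \<in> \<Lambda>"
    and "\<And>x. x \<in> \<Lambda> \<Longrightarrow> \<pi> ((f ^^ K) x) = shift1 (\<pi> x)"
  using assms unfolding horseshoe_def subsystem_def by (simp_all add: image_subset_iff)

lemma horseshoe_iterate:
  assumes "horseshoe X f K \<Lambda> \<pi>" "x \<in> \<Lambda>"
  shows "(f ^^ (K * m)) x \<in> \<Lambda> \<and> \<pi> ((f ^^ (K * m)) x) = (\<lambda>n. \<pi> x (n + m))"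
proof (induction m)
  case (Suc m)
  have "(f ^^ (K * Suc m)) x = (f ^^ K) ((f ^^ (K * m)) x)"
    by (simp add: funpow_add)
  with Suc show ?case
    using horseshoeD(6,7)[OF assms(1)] by (simp add: shift1_def)
qed (simp add: assms)

lemma tds_funpow:
  assumes "tds X f"
  shows "continuous_on X (f ^^ n) \<and> (f ^^ n) ` X \<subseteq> X"
proof (induction n)
  case (Suc n)
  then have "continuous_on ((f ^^ n) ` X) f"
    using assms by (auto simp: tds_def intro: continuous_on_subset)
  with Suc have "continuous_on X (f \<circ> f ^^ n)"
    by (intro continuous_on_compose) auto
  moreover have "(f \<circ> f ^^ n) ` X \<subseteq> X"
    using Suc assms by (auto simp: tds_def)
  ultimately show ?case
    by simp
qed simp

lemma compact_funpow_image:
  assumes "tds X f" "compact S" "S \<subseteq> X"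
  shows "compact ((f ^^ n) ` S)"
proof (rule compact_continuous_image)
  show "continuous_on S (f ^^ n)"
    using tds_funpow[OF assms(1), of n] assms(3) by (blast intro: continuous_on_subset)
qed (fact assms(2))

text \<open>The set of phases is shifted by f (up to growth). A horseshoe in which it has at most
  one element comes with a clock that can be read off from the point.\<close>

definition phases :: "('a \<Rightarrow> 'a) \<Rightarrow> nat \<Rightarrow> 'a set \<Rightarrow> 'a \<Rightarrow> nat set" where
  "phases f K \<Lambda> z = {i. i < K \<and> z \<in> (f ^^ i) ` \<Lambda>}"

lemma finite_phases [simp]: "finite (phases f K \<Lambda> z)"
  by (rule finite_subset[of _ "{..<K}"]) (auto simp: phases_def)

text \<open>Complete periods \<open>K\<close> can be run first, inside the invariant set
  \<open>\<Lambda>\<close>, so only the remainder of the time counts.\<close>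

lemma phases_add:
  assumes h: "horseshoe X f K \<Lambda> \<pi>" and i: "z \<in> (f ^^ i) ` \<Lambda>"
  shows "(i + n) mod K \<in> phases f K \<Lambda> ((f ^^ n) z)"
proof -
  obtain x where x: "x \<in> \<Lambda>" "z = (f ^^ i) x"
    using i by blast
  define a b where "a = (i + n) mod K" and "b = K * ((i + n) div K)"
  have "n + i = a + b"
    by (simp add: a_def b_def)
  moreover have "(f ^^ n) z = (f ^^ (n + i)) x"
    by (simp add: x(2) funpow_add)
  ultimately have "(f ^^ n) z = (f ^^ a) ((f ^^ b) x)"
    by (simp add: funpow_add)
  moreover have "(f ^^ b) x \<in> \<Lambda>"
    using horseshoe_iterate[OF h x(1)] by (simp add: b_def)
  ultimately have "(f ^^ n) z \<in> (f ^^ a) ` \<Lambda>"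
    by blast
  then show ?thesis
    using horseshoeD(1)[OF h] by (simp add: phases_def a_def)
qed

text \<open>The preimage of a block shift, with the data bits as new symbols. A phase
  \<open>i\<close> is determined by \<open>i mod K\<close>: the code seen from \<open>z\<close>
  onwards shows the position inside a block, which is \<open>i div K\<close> up to a known
  shift.\<close>

lemma coded_subhorseshoe:
  assumes h: "horseshoe X f K \<Lambda> \<pi>" and "q > 0"
  shows "\<exists>l \<Lambda>' \<pi>'. q dvd l \<and> \<Lambda>' \<subseteq> \<Lambda> \<and> horseshoe X f (K * l) \<Lambda>' \<pi>' \<and>
    (\<forall>x\<in>\<Lambda>'. occurs w (\<pi> x)) \<and>
    (\<forall>z. inj_on (\<lambda>i. i mod K) (phases f (K * l) \<Lambda>' z))"
proof -
  obtain l p t where l: "q dvd l" "l > 0" "p < l"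
    and occ: "\<forall>s\<in>block_shift l p t. occurs w s"
    and recog: "\<forall>s\<in>block_shift l p t. \<forall>s'\<in>block_shift l p t. \<forall>a b.
      (\<forall>n. s (n + a) = s' (n + b)) \<longrightarrow> a mod l = b mod l"
    using block_shift_exists[OF \<open>q > 0\<close>, of w] by (elim exE conjE) (rule that)
  note hD = horseshoeD[OF h]
  define \<Lambda>' where "\<Lambda>' = {x \<in> \<Lambda>. \<pi> x \<in> block_shift l p t}"
  define \<pi>' where "\<pi>' x k = \<pi> x (k * l + p)" for x k
  have sub: "\<Lambda>' \<subseteq> \<Lambda>"
    by (auto simp: \<Lambda>'_def)
  have iter: "(f ^^ (K * l)) x \<in> \<Lambda>' \<and> \<pi> ((f ^^ (K * l)) x) = (\<lambda>n. \<pi> x (n + l))" if "x \<in> \<Lambda>'" for x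
    using horseshoe_iterate[OF h, of x l] that block_shift_shift by (auto simp: \<Lambda>'_def)
  have surj: "\<exists>x\<in>\<Lambda>'. \<pi>' x = d" for d
  proof -
    define s where "s n = (if n mod l = p then d (n div l) else t (n mod l))" for n
    obtain x where x: "x \<in> \<Lambda>" "\<pi> x = s"
      using hD(5) by (metis UNIV_I imageE)
    moreover have "s \<in> block_shift l p t"
      by (simp add: block_shift_def s_def)
    moreover have "\<pi>' x k = d k" for k
      using x l(3) by (simp add: \<pi>'_def s_def)
    ultimately show ?thesis
      by (intro bexI[of _ x]) (auto simp: \<Lambda>'_def)
  qed
  have "closedin (top_of_set \<Lambda>) (\<Lambda> \<inter> \<pi> -` block_shift l p t)"
    using hD(4) closed_block_shift by (rule continuous_closedin_preimage)
  with hD(2) have "compact (\<Lambda> \<inter> \<pi> -` block_shift l p t)"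
    by (rule closedin_compact)
  moreover have "\<Lambda> \<inter> \<pi> -` block_shift l p t = \<Lambda>'"
    by (auto simp: \<Lambda>'_def)
  ultimately have "compact \<Lambda>'"
    by simp
  moreover have "continuous_on \<Lambda>' \<pi>"
    using hD(4) sub by (rule continuous_on_subset)
  then have "continuous_on \<Lambda>' (\<lambda>x. \<pi>' x k)" for k
    unfolding \<pi>'_def by (rule continuous_on_product_then_coordinatewise)
  then have cont: "continuous_on \<Lambda>' \<pi>'"
    by (rule continuous_on_coordinatewise_then_product)
  moreover have "\<pi>' ((f ^^ (K * l)) x) = shift1 (\<pi>' x)" if "x \<in> \<Lambda>'" for x
    using iter[OF that] by (auto simp: \<pi>'_def shift1_def algebra_simps)
  moreover have "\<pi>' ` \<Lambda>' = UNIV"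
    using surj by (auto simp: image_iff set_eq_iff) metis
  ultimately have h': "horseshoe X f (K * l) \<Lambda>' \<pi>'"
    using hD(1,3) l(2) sub iter surj cont by (auto simp: horseshoe_def subsystem_def)
  have inj: "i = j" if ij: "i \<in> phases f (K * l) \<Lambda>' z" "j \<in> phases f (K * l) \<Lambda>' z"
    "i mod K = j mod K" for z i j
  proof -
    obtain x where x: "x \<in> \<Lambda>'" "z = (f ^^ i) x" and i: "i < K * l"
      using ij(1) by (auto simp: phases_def)
    obtain y where y: "y \<in> \<Lambda>'" "z = (f ^^ j) y" and j: "j < K * l"
      using ij(2) by (auto simp: phases_def)
    \<comment> \<open>After \<open>c\<close> more steps both representations of \<open>z\<close>
      have run a multiple of \<open>K\<close>. They then describe one point of
      \<open>\<Lambda>\<close>, so the tails of the two codes can be compared.\<close>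
    define c where "c = K - i mod K"
    have "K - n mod K + n = K * (n div K + 1)" for n
    proof -
      have "n mod K < K" "K * (n div K) + n mod K = n"
        using hD(1) by simp_all
      then show ?thesis
        unfolding distrib_left by linarith
    qed
    from this[of i] this[of j] have c: "c + i = K * (i div K + 1)" "c + j = K * (j div K + 1)"
      using ij(3) by (simp_all add: c_def)
    have "(f ^^ (c + i)) x = (f ^^ (c + j)) y"
      using x(2) y(2) by (simp add: funpow_add)
    then have eq: "(f ^^ (K * (i div K + 1))) x = (f ^^ (K * (j div K + 1))) y"
      unfolding c .
    have "(\<lambda>n. \<pi> x (n + (i div K + 1))) = (\<lambda>n. \<pi> y (n + (j div K + 1)))"
      using horseshoe_iterate[OF h, of x "i div K + 1"] horseshoe_iterate[OF h, of y "j div K + 1"]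
        x(1) y(1) sub eq by (metis subsetD)
    then have "\<pi> x (n + (i div K + 1)) = \<pi> y (n + (j div K + 1))" for n
      by (rule fun_cong)
    moreover have "\<pi> x \<in> block_shift l p t" "\<pi> y \<in> block_shift l p t"
      using x(1) y(1) by (auto simp: \<Lambda>'_def)
    ultimately have "(i div K + 1) mod l = (j div K + 1) mod l"
      using recog by blast
    moreover have "i div K < l" "j div K < l"
      using i j by (simp_all add: less_mult_imp_div_less mult.commute)
    ultimately have "i div K = j div K"
      by (auto simp: mod_Suc split: if_splits)
    with ij(3) show "i = j"
      by (metis mult_div_mod_eq)
  qed
  have "\<forall>x\<in>\<Lambda>'. occurs w (\<pi> x)"
    using occ by (simp add: \<Lambda>'_def)
  moreover have "inj_on (\<lambda>i. i mod K) (phases f (K * l) \<Lambda>' z)" for z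
    by (rule inj_onI) (rule inj)
  ultimately show ?thesis
    using l(1) sub h' by blast
qed

text \<open>Induction on \<open>r\<close>, with the order, the set and the factor map varying and
  the modulus \<open>N\<close> fixed. Injectivity modulo \<open>N\<close> survives a recoding
  because \<open>N\<close> divides \<open>K\<close>: phases congruent modulo \<open>N\<close> are
  congruent modulo the old order, hence equal. The base case is void, since points of a horseshoe
  have phase 0.\<close>

lemma clocked_horseshoe_if_bounded_phases:
  assumes X: "tds X f" and N: "N > 0" "N * N dvd K"
    and h: "horseshoe X f K \<Lambda> \<pi>"
    and inj: "\<forall>z. inj_on (\<lambda>i. i mod N) (phases f K \<Lambda> z)"
    and bound: "\<forall>z. card (phases f K \<Lambda> z) \<le> r"
  shows "\<exists>K \<Gamma> \<pi>. horseshoe X f K \<Gamma> \<pi> \<and> (\<forall>i. 0 < i \<and> i < K \<longrightarrow> \<Gamma> \<inter> (f ^^ i) ` \<Gamma> = {})"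
  using N(2) h inj bound
proof (induction r arbitrary: K \<Lambda> \<pi>)
  case 0
  have "0 \<in> phases f K \<Lambda> x" if "x \<in> \<Lambda>" for x
    using that horseshoeD(1)[OF 0(2)] by (auto simp: phases_def)
  moreover obtain x where "x \<in> \<Lambda>"
    using horseshoeD(5)[OF 0(2)] by auto
  ultimately have "card (phases f K \<Lambda> x) > 0"
    by (auto simp: card_gt_0_iff)
  with 0(4) show ?case
    by (metis not_le)
next
  case (Suc r)
  note h = Suc.prems(2) and bound = Suc.prems(4)
  have inj: "i = j" if "i \<in> phases f K \<Lambda> z" "j \<in> phases f K \<Lambda> z" "i mod N = j mod N" for z i j
    using Suc.prems(3) that by (meson inj_onD)
  note hD = horseshoeD[OF h]
  \<comment> \<open>Inclusion instead of equality makes \<open>core Q\<close> compact and invariant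
    under \<open>f ^^ K\<close>. For \<open>Q\<close> of the maximal size \<open>Suc r\<close> the
    two conditions coincide.\<close>
  define core where "core Q = {x \<in> \<Lambda>. Q \<subseteq> phases f K \<Lambda> x}" for Q
  define \<Q> where "\<Q> = {Q. Q \<subseteq> {..<K} \<and> 0 \<in> Q \<and> card Q = Suc r}"
  have core_phase: "(f ^^ K) x \<in> core Q" if "x \<in> core Q" for x Q
  proof -
    have "i \<in> phases f K \<Lambda> ((f ^^ K) x)" if "i \<in> Q" for i
      using phases_add[OF h, of x i K] \<open>x \<in> core Q\<close> that by (auto simp: core_def phases_def)
    then show ?thesis
      using that hD(6) by (auto simp: core_def)
  qed
  have core_compact: "compact (core Q)" if "Q \<in> \<Q>" for Q
  proof -
    have "core Q = \<Lambda> \<inter> (\<Inter>i\<in>Q. (f ^^ i) ` \<Lambda>)"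
      using that by (auto simp: core_def phases_def \<Q>_def)
    moreover have "closed (\<Inter>i\<in>Q. (f ^^ i) ` \<Lambda>)"
      using compact_funpow_image[OF X hD(2,3)] by (intro closed_INT) (auto intro: compact_imp_closed)
    ultimately show ?thesis
      using hD(2) by (simp add: compact_Int_closed)
  qed
  show ?case
  proof (cases "\<exists>Q\<in>\<Q>. \<pi> ` core Q = UNIV")
    case True
    \<comment> \<open>By maximality of Q, a return of core Q to itself at time i makes Q invariant under
      translation by i; injectivity modulo N and N * N dvd K then force i = 0.\<close>
    then obtain Q where Q: "Q \<in> \<Q>" "\<pi> ` core Q = UNIV"
      by blast
    then have Q': "Q \<subseteq> {..<K}" "0 \<in> Q" "card Q = Suc r" "finite Q"
      by (auto simp: \<Q>_def intro: finite_subset)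
    have sub: "core Q \<subseteq> \<Lambda>"
      by (auto simp: core_def)
    have "horseshoe X f K (core Q) \<pi>"
      unfolding horseshoe_def subsystem_def
      using hD(1,3,7) Q sub core_phase core_compact continuous_on_subset[OF hD(4) sub] by auto
    moreover have "core Q \<inter> (f ^^ i) ` core Q = {}" if i: "0 < i" "i < K" for i
    proof (rule ccontr)
      assume "core Q \<inter> (f ^^ i) ` core Q \<noteq> {}"
      then obtain y where y: "y \<in> core Q" "(f ^^ i) y \<in> core Q"
        by blast
      let ?P = "phases f K \<Lambda> ((f ^^ i) y)"
      have "Q \<subseteq> ?P"
        using y(2) by (simp add: core_def)
      moreover have "card ?P \<le> card Q"
        using bound Q'(3) by simp
      ultimately have QP: "Q = ?P"
        by (intro card_seteq) auto
      have step: "(j + i) mod K \<in> Q" if "j \<in> Q" for j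
        unfolding QP using phases_add[OF h, of y j i] y(1) that by (auto simp: core_def phases_def)
      have "(n * i) mod K \<in> Q" for n
      proof (induction n)
        case (Suc n)
        from step[OF this] show ?case
          by (simp add: mod_simps add.commute)
      qed (use Q' in simp)
      \<comment> \<open>Injectivity modulo \<open>N\<close> is applied twice. First,
        \<open>(N * i) mod K\<close> and 0 agree modulo \<open>N\<close>, so \<open>K\<close>
        divides \<open>N * i\<close>, and \<open>N * N dvd K\<close> makes \<open>i\<close> a
        multiple of \<open>N\<close>. Then \<open>i\<close> and 0 agree modulo
        \<open>N\<close>.\<close>
      then have mem: "(N * i) mod K \<in> ?P" "0 \<in> ?P" "i \<in> ?P"
        using Q'(2) step[OF Q'(2)] i(2) unfolding QP[symmetric] by auto
      have NK: "N dvd K"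
        using Suc.prems(1) by (metis dvd_mult_left)
      have "(N * i) mod K = 0"
        using inj[OF mem(1,2)] NK by (simp add: mod_mod_cancel)
      then have "N * N dvd N * i"
        using Suc.prems(1) by (meson dvd_trans mod_0_imp_dvd)
      then have "i mod N = 0 mod N"
        using N by simp
      from inj[OF mem(3,2) this] i show False
        by simp
    qed
    ultimately show ?thesis
      by blast
  next
    case False
    \<comment> \<open>Every core misses a word; coding with blocks that contain all these words destroys
      all phase sets of size r + 1.\<close>
    have "finite \<Q>"
      by (rule finite_subset[of _ "Pow {..<K}"]) (auto simp: \<Q>_def)
    have "closed (\<pi> ` core Q) \<and> \<pi> ` core Q \<noteq> UNIV \<and> shift1 ` \<pi> ` core Q \<subseteq> \<pi> ` core Q" if "Q \<in> \<Q>" for Q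
    proof (intro conjI)
      have "continuous_on (core Q) \<pi>"
        using hD(4) by (rule continuous_on_subset) (auto simp: core_def)
      then show "closed (\<pi> ` core Q)"
        using core_compact[OF that] by (intro compact_imp_closed_bool_seq compact_continuous_image)
      show "\<pi> ` core Q \<noteq> UNIV"
        using False that by blast
      have "shift1 (\<pi> x) \<in> \<pi> ` core Q" if "x \<in> core Q" for x
        using core_phase[OF that] hD(7)[of x] that by (metis (no_types, lifting) core_def imageI mem_Collect_eq)
      then show "shift1 ` \<pi> ` core Q \<subseteq> \<pi> ` core Q"
        by blast
    qed
    then have "\<exists>w. \<forall>S\<in>(\<lambda>Q. \<pi> ` core Q) ` \<Q>. \<forall>s\<in>S. \<not> occurs w s"
      using \<open>finite \<Q>\<close> by (intro missing_word_family) auto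
    then obtain w where "\<forall>S\<in>(\<lambda>Q. \<pi> ` core Q) ` \<Q>. \<forall>s\<in>S. \<not> occurs w s" ..
    then have w: "\<forall>Q\<in>\<Q>. \<forall>x\<in>core Q. \<not> occurs w (\<pi> x)"
      by simp
    obtain l \<Lambda>' \<pi>' where l: "\<Lambda>' \<subseteq> \<Lambda>" "horseshoe X f (K * l) \<Lambda>' \<pi>'"
      and occ: "\<forall>x\<in>\<Lambda>'. occurs w (\<pi> x)"
      and inj_K: "\<forall>z. inj_on (\<lambda>i. i mod K) (phases f (K * l) \<Lambda>' z)"
      using coded_subhorseshoe[OF h zero_less_one, of w] by (elim exE conjE) (rule that)
    let ?P = "phases f (K * l) \<Lambda>'"
    have inj': "i = j" if "i \<in> ?P z" "j \<in> ?P z" "i mod K = j mod K" for z i j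
      using inj_K that by (meson inj_onD)
    have mod_phase: "(i + n) mod K \<in> phases f K \<Lambda> ((f ^^ n) z)" if "i \<in> ?P z" for i n z
    proof -
      have "z \<in> (f ^^ i) ` \<Lambda>"
        using that l(1) by (auto simp: phases_def)
      then show ?thesis
        by (rule phases_add[OF h])
    qed
    have "N dvd K"
      using Suc.prems(1) by (metis dvd_mult_left)
    show ?thesis
    proof (rule Suc.IH[OF _ l(2)])
      show "N * N dvd K * l"
        using Suc.prems(1) by simp
    next
      show "\<forall>z. inj_on (\<lambda>i. i mod N) (?P z)"
      proof (intro allI inj_onI)
        fix z i j assume ij: "i \<in> ?P z" "j \<in> ?P z" "i mod N = j mod N"
        then have "i mod K \<in> phases f K \<Lambda> z" "j mod K \<in> phases f K \<Lambda> z"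
          using mod_phase[of i z 0] mod_phase[of j z 0] by auto
        then have "i mod K = j mod K"
          by (rule inj) (use ij(3) \<open>N dvd K\<close> in \<open>simp add: mod_mod_cancel\<close>)
        then show "i = j"
          by (rule inj'[OF ij(1,2)])
      qed
    next
      show "\<forall>z. card (?P z) \<le> r"
      proof (intro allI, rule ccontr)
        fix z
        assume big: "\<not> card (?P z) \<le> r"
        then obtain i0 where i0: "i0 \<in> ?P z"
          by (metis card.empty ex_in_conv le0)
        then obtain x where x: "x \<in> \<Lambda>'" "z = (f ^^ i0) x" "i0 < K * l"
          by (auto simp: phases_def)
        \<comment> \<open>The time \<open>c\<close> brings \<open>z\<close> back to a point
          \<open>y\<close> of \<open>\<Lambda>'\<close> and turns the phases of \<open>z\<close>
          into equally many phases of \<open>y\<close> modulo \<open>K\<close>, with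
          \<open>i0\<close> becoming 0. Hence \<open>y\<close> lies in some core, although its code
          contains \<open>w\<close>.\<close>
        define c where "c = K * l - i0"
        define y where "y = (f ^^ c) z"
        have c: "c + i0 = K * l"
          using x(3) by (simp add: c_def)
        have "y = (f ^^ (K * l)) x"
          by (simp add: y_def x(2) c[symmetric] funpow_add)
        then have y: "y \<in> \<Lambda>'"
          using horseshoeD(6)[OF l(2) x(1)] by simp
        define Q where "Q = (\<lambda>i. (i + c) mod K) ` ?P z"
        have QP: "Q \<subseteq> phases f K \<Lambda> y"
          using mod_phase by (auto simp: Q_def y_def)
        have "inj_on (\<lambda>i. (i + c) mod K) (?P z)"
        proof (rule inj_onI)
          fix i j assume ij: "i \<in> ?P z" "j \<in> ?P z" "(i + c) mod K = (j + c) mod K"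
          then have "i mod K = j mod K"
            unfolding nat_mod_eq_iff by (metis add.assoc add.commute add_left_cancel)
          then show "i = j"
            by (rule inj'[OF ij(1,2)])
        qed
        then have "card Q = card (?P z)"
          unfolding Q_def by (rule card_image)
        moreover have "card Q \<le> Suc r"
          using QP bound by (meson card_mono finite_phases le_trans)
        ultimately have "card Q = Suc r"
          using big by simp
        moreover have "0 \<in> Q"
          unfolding Q_def by (rule image_eqI[OF _ i0]) (use c in \<open>simp add: add.commute\<close>)
        moreover have "Q \<subseteq> {..<K}"
          using hD(1) by (auto simp: Q_def)
        ultimately have "Q \<in> \<Q>"
          by (simp add: \<Q>_def)
        moreover have "y \<in> core Q"
          using QP y l(1) by (auto simp: core_def)
        ultimately show False
          using w occ y by blast
      qed
    qed
  qed
qed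

lemma clocked_horseshoe_exists:
  assumes X: "tds X f" and "has_semi_horseshoe X f"
  shows "\<exists>K \<Gamma> \<pi>. horseshoe X f K \<Gamma> \<pi> \<and> (\<forall>i. 0 < i \<and> i < K \<longrightarrow> \<Gamma> \<inter> (f ^^ i) ` \<Gamma> = {})"
proof -
  obtain N \<Lambda> where "N \<ge> 1"
    and cases: "one_sided_semi_horseshoe X f N \<Lambda> \<or> two_sided_semi_horseshoe X f N \<Lambda>"
    using assms(2) by (auto simp: has_semi_horseshoe_def)
  then have N: "N > 0"
    by simp
  from cases have "\<exists>\<pi>. horseshoe X f N \<Lambda> \<pi>"
  proof
    assume "one_sided_semi_horseshoe X f N \<Lambda>"
    with N show ?thesis
      unfolding one_sided_semi_horseshoe_def horseshoe_def by auto
  next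
    assume "two_sided_semi_horseshoe X f N \<Lambda>"
    then obtain \<rho> :: "'a \<Rightarrow> int \<Rightarrow> bool" where \<rho>: "subsystem X (f ^^ N) \<Lambda>" "continuous_on \<Lambda> \<rho>"
      "\<rho> ` \<Lambda> = UNIV" "\<forall>x\<in>\<Lambda>. \<rho> ((f ^^ N) x) = shift2 (\<rho> x)"
      unfolding two_sided_semi_horseshoe_def by (elim exE conjE) (rule that)
    define \<pi> where "\<pi> x n = \<rho> x (int n)" for x n
    have "continuous_on \<Lambda> (\<lambda>x. \<pi> x n)" for n
      unfolding \<pi>_def using \<rho>(2) by (rule continuous_on_product_then_coordinatewise)
    then have "continuous_on \<Lambda> \<pi>"
      by (rule continuous_on_coordinatewise_then_product)
    moreover have "\<exists>x\<in>\<Lambda>. s = \<pi> x" for s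
    proof -
      \<comment> \<open>Since \<open>nat\<close> is 0 at negative integers, this extends
        \<open>s\<close> to the left by the constant \<open>s 0\<close>.\<close>
      have "(\<lambda>i. s (nat i)) \<in> \<rho> ` \<Lambda>"
        by (simp add: \<rho>(3))
      then obtain x where x: "x \<in> \<Lambda>" "(\<lambda>i. s (nat i)) = \<rho> x"
        by (rule imageE)
      have "s n = \<pi> x n" for n
        using fun_cong[OF x(2), of "int n"] by (simp add: \<pi>_def)
      with x(1) show ?thesis
        by blast
    qed
    then have "\<pi> ` \<Lambda> = UNIV"
      by (simp add: image_def)
    moreover have "\<pi> ((f ^^ N) x) = shift1 (\<pi> x)" if "x \<in> \<Lambda>" for x
      using \<rho>(4) that by (simp add: \<pi>_def shift1_def shift2_def fun_eq_iff add.commute)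
    ultimately show ?thesis
      using \<rho>(1) N unfolding horseshoe_def by auto
  qed
  then obtain \<pi> where h: "horseshoe X f N \<Lambda> \<pi>"
    by blast
  \<comment> \<open>A first recoding with the empty word starts the induction: it yields injectivity
    modulo \<open>N\<close>, and \<open>q = N\<close> makes the new order divisible by
    \<open>N * N\<close>.\<close>
  obtain l \<Lambda>' \<pi>' where l: "N dvd l" "horseshoe X f (N * l) \<Lambda>' \<pi>'"
    and inj: "\<forall>z. inj_on (\<lambda>i. i mod N) (phases f (N * l) \<Lambda>' z)"
    using coded_subhorseshoe[OF h N, of "[]"] by (elim exE conjE) (rule that)
  have "\<forall>z. card (phases f (N * l) \<Lambda>' z) \<le> N * l"
  proof
    have "phases f (N * l) \<Lambda>' z \<subseteq> {..<N * l}" for z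
      by (auto simp: phases_def)
    then show "card (phases f (N * l) \<Lambda>' z) \<le> N * l" for z
      using card_mono[of "{..<N * l}"] by fastforce
  qed
  moreover have "N * N dvd N * l"
    using l(1) by (simp add: mult_dvd_mono)
  ultimately show ?thesis
    using clocked_horseshoe_if_bounded_phases[OF X N _ l(2) inj] by blast
qed

section \<open>Points correlated with the weight\<close>

text \<open>Nonnegativity keeps the liminf at or above 0, so a limsup that is not positive forces
  convergence to 0. Positive upper averages can then be handled by limit rules for real
  sequences.\<close>

lemma limsup_pos_iff:
  fixes a :: "nat \<Rightarrow> real"
  assumes "\<And>n. a n \<ge> 0"
  shows "limsup (\<lambda>n. ereal (a n)) > 0 \<longleftrightarrow> \<not> a \<longlonglongrightarrow> 0"
proof
  assume "limsup (\<lambda>n. ereal (a n)) > 0"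
  moreover have "limsup (\<lambda>n. ereal (a n)) = 0" if "a \<longlonglongrightarrow> 0"
    using that by (intro lim_imp_Limsup) (auto simp: zero_ereal_def)
  ultimately show "\<not> a \<longlonglongrightarrow> 0"
    by auto
next
  assume a: "\<not> a \<longlonglongrightarrow> 0"
  show "limsup (\<lambda>n. ereal (a n)) > 0"
  proof (rule ccontr)
    assume "\<not> limsup (\<lambda>n. ereal (a n)) > 0"
    moreover have "0 \<le> liminf (\<lambda>n. ereal (a n))"
      using assms by (intro Liminf_bounded) auto
    moreover have "liminf (\<lambda>n. ereal (a n)) \<le> limsup (\<lambda>n. ereal (a n))"
      by (intro Liminf_le_Limsup) simp
    ultimately have "liminf (\<lambda>n. ereal (a n)) = 0" "limsup (\<lambda>n. ereal (a n)) = 0"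
      by order+
    then have "(\<lambda>n. ereal (a n)) \<longlonglongrightarrow> ereal 0"
      by (intro Liminf_eq_Limsup) (auto simp: zero_ereal_def)
    with a show False
      by simp
  qed
qed

text \<open>The Urysohn function given by a quotient of distances. Nonemptiness matters because
  \<open>infdist\<close> to the empty set is 0.\<close>

lemma metric_separation:
  fixes A B :: "'a::metric_space set"
  assumes "closed A" "closed B" "A \<noteq> {}" "B \<noteq> {}" "A \<inter> B = {}"
  shows "\<exists>\<phi> :: 'a \<Rightarrow> real. continuous_on UNIV \<phi> \<and> (\<forall>z\<in>A. \<phi> z = 1) \<and> (\<forall>z\<in>B. \<phi> z = 0)"
proof -
  define \<phi> where "\<phi> z = infdist z B / (infdist z A + infdist z B)" for z
  have pos: "infdist z A + infdist z B \<noteq> 0" for z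
  proof
    assume "infdist z A + infdist z B = 0"
    then have "infdist z A = 0" "infdist z B = 0"
      using infdist_nonneg[of z A] infdist_nonneg[of z B] by linarith+
    with assms show False
      by (metis IntI empty_iff in_closed_iff_infdist_zero)
  qed
  have "continuous_on UNIV \<phi>"
    unfolding \<phi>_def by (intro continuous_intros) (simp add: pos)
  moreover have "\<phi> z = 1" if "z \<in> A" for z
    using pos[of z] that by (simp add: \<phi>_def)
  moreover have "\<phi> z = 0" if "z \<in> B" for z
    using that by (simp add: \<phi>_def)
  ultimately show ?thesis
    by blast
qed

lemma separate_compact_compact:
  fixes A B :: "'a::metric_space set"
  assumes "compact A" "compact B" "A \<inter> B = {}"
  shows "\<exists>d>0. \<forall>u\<in>A. \<forall>v\<in>B. d \<le> dist u v"
proof (cases "A \<times> B = {}")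
  case True
  then show ?thesis
    by (intro exI[of _ 1]) auto
next
  case False
  have "continuous_on (A \<times> B) (\<lambda>p. dist (fst p) (snd p))"
    by (intro continuous_intros)
  then obtain p where p: "p \<in> A \<times> B" "\<forall>q\<in>A \<times> B. dist (fst p) (snd p) \<le> dist (fst q) (snd q)"
    using continuous_attains_inf[OF compact_Times[OF assms(1,2)] False] by blast
  moreover have "dist (fst p) (snd p) > 0"
    using p(1) assms(3) by auto
  ultimately show ?thesis
    by (intro exI[of _ "dist (fst p) (snd p)"]) auto
qed

text \<open>The average of the absolute values is the sum of the 2K averages of the positive and
  negative parts over the residue classes, so these cannot all tend to 0.\<close>

lemma nontrivial_weight_residue:
  assumes "nontrivial_weight \<theta>" "K > 0"
  obtains j and \<sigma> :: real where "j < K" "\<sigma> = 1 \<or> \<sigma> = - 1"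
    "\<not> (\<lambda>M. 1 / real M * (\<Sum>n<M. if n mod K = j then max 0 (\<sigma> * \<theta> n) else 0)) \<longlonglongrightarrow> 0"
proof (rule ccontr)
  define b where "b j \<sigma> M = 1 / real M * (\<Sum>n<M. if n mod K = j then max 0 (\<sigma> * \<theta> n) else 0)"
    for j \<sigma> M
  assume "\<not> thesis"
  with that have "b j 1 \<longlonglongrightarrow> 0" "b j (- 1) \<longlonglongrightarrow> 0" if "j < K" for j
    using \<open>j < K\<close> unfolding b_def by blast+
  then have "(\<lambda>M. \<Sum>j<K. b j 1 M + b j (- 1) M) \<longlonglongrightarrow> (\<Sum>j<K. 0 + 0)"
    by (intro tendsto_sum tendsto_add) auto
  moreover have "(\<Sum>j<K. b j 1 M + b j (- 1) M) = 1 / real M * (\<Sum>n<M. \<bar>\<theta> n\<bar>)" for M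
  proof -
    have "b j 1 M + b j (- 1) M = 1 / real M * (\<Sum>n<M. if n mod K = j then \<bar>\<theta> n\<bar> else 0)" for j
      unfolding b_def distrib_left[symmetric] sum.distrib[symmetric]
      by (intro arg_cong[of _ _ "(*) (1 / real M)"] sum.cong) auto
    then have "(\<Sum>j<K. b j 1 M + b j (- 1) M)
        = 1 / real M * (\<Sum>j<K. \<Sum>n<M. if n mod K = j then \<bar>\<theta> n\<bar> else 0)"
      by (simp add: sum_distrib_left)
    also have "(\<Sum>j<K. \<Sum>n<M. if n mod K = j then \<bar>\<theta> n\<bar> else 0)
        = (\<Sum>n<M. \<Sum>j<K. if n mod K = j then \<bar>\<theta> n\<bar> else 0)"
      by (rule sum.swap)
    also have "\<dots> = (\<Sum>n<M. \<bar>\<theta> n\<bar>)"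
      using \<open>K > 0\<close> by (intro sum.cong refl) simp
    finally show ?thesis .
  qed
  ultimately have "(\<lambda>M. 1 / real M * (\<Sum>n<M. \<bar>\<theta> n\<bar>)) \<longlonglongrightarrow> 0"
    by simp
  moreover have "limsup (\<lambda>M. ereal (1 / real M * (\<Sum>n<M. \<bar>\<theta> n\<bar>))) > 0"
    using assms(1) by (simp add: nontrivial_weight_def)
  ultimately show False
    by (subst (asm) limsup_pos_iff) (auto intro: sum_nonneg)
qed

text \<open>These times are of the form \<open>K * (R * m) + j\<close> with m at most
  \<open>M div R\<close>. Giving away the factor \<open>K\<close> in the density is harmless, as
  \<open>R\<close> is free to be large.\<close>

lemma card_sparse_residue:
  assumes "K > 0" "R > 0"
  shows "real (card {n. n < M \<and> n mod K = j \<and> R dvd n div K}) \<le> real M / real R + 1"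
proof -
  have "{n. n < M \<and> n mod K = j \<and> R dvd n div K} \<subseteq> (\<lambda>m. K * (R * m) + j) ` {..M div R}"
  proof clarify
    fix n assume n: "n < M" "j = n mod K" "R dvd n div K"
    then obtain m where m: "n div K = R * m"
      by blast
    have "R * m \<le> M"
      using n(1) m div_le_dividend[of n K] by simp
    then have "m \<le> M div R"
      using \<open>R > 0\<close> by (simp add: less_eq_div_iff_mult_less_eq mult.commute)
    moreover have "n = K * (R * m) + n mod K"
      using m by (metis mult_div_mod_eq)
    ultimately show "n \<in> (\<lambda>m. K * (R * m) + n mod K) ` {..M div R}"
      by blast
  qed
  then have "card {n. n < M \<and> n mod K = j \<and> R dvd n div K}
      \<le> card ((\<lambda>m. K * (R * m) + j) ` {..M div R})"
    by (intro card_mono) auto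
  also have "\<dots> \<le> M div R + 1"
    using card_image_le[of "{..M div R}" "\<lambda>m. K * (R * m) + j"] by simp
  finally have "real (card {n. n < M \<and> n mod K = j \<and> R dvd n div K}) \<le> real (M div R) + 1"
    by linarith
  also have "real (M div R) \<le> real M / real R"
    by (rule of_nat_div_le_of_nat)
  finally show ?thesis
    by simp
qed

theorem theorem8p1:
  fixes X :: "'a::metric_space set" and f :: "'a \<Rightarrow> 'a" and \<theta> :: "nat \<Rightarrow> real"
  assumes "tds X f"
    and "has_semi_horseshoe X f"
    and "nontrivial_weight \<theta>"
  shows "htop X f (weighted_set \<theta> f X) > 0"
proof -

  \<comment> \<open>Choice of the residue class, the sign and the density of free symbols\<close>
  obtain K \<Gamma> \<pi> where h: "horseshoe X f K \<Gamma> \<pi>"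
    and disj: "\<forall>i. 0 < i \<and> i < K \<longrightarrow> \<Gamma> \<inter> (f ^^ i) ` \<Gamma> = {}"
    using clocked_horseshoe_exists[OF assms(1,2)] by (elim exE conjE) (rule that)
  note hD = horseshoeD[OF h]
  obtain j and \<sigma> :: real where j: "j < K" and \<sigma>: "\<sigma> = 1 \<or> \<sigma> = - 1"
    and nonnull: "\<not> (\<lambda>M. 1 / real M * (\<Sum>n<M. if n mod K = j then max 0 (\<sigma> * \<theta> n) else 0)) \<longlonglongrightarrow> 0"
    by (rule nontrivial_weight_residue[OF assms(3) hD(1)])
  define b where "b M = 1 / real M * (\<Sum>n<M. if n mod K = j then max 0 (\<sigma> * \<theta> n) else 0)" for M
  have b_nonneg: "b M \<ge> 0" for M
    by (auto simp: b_def intro!: sum_nonneg divide_nonneg_nonneg)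
  obtain \<delta> where \<delta>: "\<delta> > 0" "\<And>M0. \<exists>M\<ge>M0. b M \<ge> \<delta>"
    using nonnull b_nonneg unfolding b_def[symmetric] LIMSEQ_def by (auto simp: not_less)
  obtain C where C: "C > 0" "\<And>n. \<bar>\<theta> n\<bar> \<le> C"
    using assms(3) by (auto simp: nontrivial_weight_def bounded_pos)
  obtain R :: nat where R: "2 * C / \<delta> < real R"
    using reals_Archimedean2 by blast
  moreover have "2 * C / \<delta> > 0"
    using C(1) \<delta>(1) by simp
  ultimately have "R > 0"
    by (metis gr0I of_nat_0 order_less_asym)
  then have R': "C / real R < \<delta> / 2"
    using R \<delta>(1) by (simp add: field_simps)

  \<comment> \<open>One bit in R is free and produces entropy; the others follow the sign of the weight. The
    free bits spoil at most C / R of the average, which is less than half of it.\<close>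
  define s where "s e n = (let k = n - 1 in if R dvd k then e (k div R) else \<sigma> * \<theta> (K * k + j) > 0)"
    for e :: "nat \<Rightarrow> bool" and n
  define y where "y e = (SOME y. y \<in> \<Gamma> \<and> \<pi> y = s e)" for e
  have y: "y e \<in> \<Gamma>" "\<pi> (y e) = s e" for e
  proof -
    have "\<exists>y. y \<in> \<Gamma> \<and> \<pi> y = s e"
      using hD(5) by (metis UNIV_I imageE)
    then have "y e \<in> \<Gamma> \<and> \<pi> (y e) = s e"
      unfolding y_def by (rule someI_ex)
    then show "y e \<in> \<Gamma>" "\<pi> (y e) = s e"
      by auto
  qed
  \<comment> \<open>Starting \<open>K - j\<close> steps late makes the orbit visit
    \<open>\<Gamma>\<close> exactly at the times n with \<open>n mod K = j\<close>, and its first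
    symbol there is symbol \<open>n div K + 1\<close> of \<open>y e\<close>. This explains the
    \<open>n - 1\<close> in \<open>s\<close>; symbol 0 is never read at these times.\<close>
  define x where "x e = (f ^^ (K - j)) (y e)" for e
  have x_X: "x e \<in> X" for e
    using tds_funpow[OF assms(1), of "K - j"] y(1) hD(3) by (auto simp: x_def)
  have orbit: "(f ^^ n) (x e) = (f ^^ i) ((f ^^ (K * m)) (y e))" if "n + (K - j) = i + K * m" for n i m e
  proof -
    have "(f ^^ n) (x e) = (f ^^ (n + (K - j))) (y e)"
      by (simp add: x_def funpow_add)
    also have "\<dots> = (f ^^ i) ((f ^^ (K * m)) (y e))"
      unfolding that by (simp add: funpow_add)
    finally show ?thesis .
  qed
  have on: "(f ^^ n) (x e) \<in> \<Gamma> \<and> \<pi> ((f ^^ n) (x e)) 0 = s e (n div K + 1)" if "n mod K = j" for n e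
  proof -
    have "n + (K - j) = 0 + K * (n div K + 1)"
      using mult_div_mod_eq[of K n] that j by simp
    then show ?thesis
      using orbit[of n 0 "n div K + 1" e] horseshoe_iterate[OF h y(1)[of e], of "n div K + 1"] y(2)[of e]
      by simp
  qed
  have off: "\<exists>i. 0 < i \<and> i < K \<and> (f ^^ n) (x e) \<in> (f ^^ i) ` \<Gamma>" if "n mod K \<noteq> j" for n e
  proof (intro exI conjI)
    let ?i = "(n + (K - j)) mod K"
    have "n + (K - j) = ?i + K * ((n + (K - j)) div K)"
      by simp
    from orbit[OF this] show "(f ^^ n) (x e) \<in> (f ^^ ?i) ` \<Gamma>"
      using horseshoe_iterate[OF h y(1)] by simp
    show "?i < K"
      using hD(1) by simp
    show "0 < ?i"
    proof (rule ccontr)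
      assume "\<not> 0 < ?i"
      then have "(n + (K - j) + j) mod K = (0 + j) mod K"
        by (metis gr0I mod_add_left_eq)
      with that j show False
        by simp
    qed
  qed

  \<comment> \<open>The test function and the separation constant\<close>
  define A where "A = {z \<in> \<Gamma>. \<pi> z 0}"
  define B where "B = {z \<in> \<Gamma>. \<not> \<pi> z 0}"
  \<comment> \<open>A function that vanishes on \<open>B'\<close> ignores all times outside the
    residue class \<open>j\<close>. Disjointness of \<open>A\<close> from \<open>B'\<close> is the
    point where the clock of \<open>\<Gamma>\<close> is needed.\<close>
  define B' where "B' = B \<union> (\<Union>i\<in>{0<..<K}. (f ^^ i) ` \<Gamma>)"
  have "closedin (top_of_set \<Gamma>) (\<Gamma> \<inter> (\<lambda>z. \<pi> z 0) -` {c})" for c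
    using continuous_on_product_then_coordinatewise[OF hD(4)] by (rule continuous_closedin_preimage) simp
  then have "compact (\<Gamma> \<inter> (\<lambda>z. \<pi> z 0) -` {c})" for c
    using hD(2) closedin_compact by blast
  from this[of True] this[of False] have compact_AB: "compact A" "compact B"
    by (simp_all add: A_def B_def vimage_def Int_def)
  moreover have "A \<inter> B = {}"
    by (auto simp: A_def B_def)
  ultimately obtain d where d: "d > 0" "\<forall>u\<in>A. \<forall>v\<in>B. d \<le> dist u v"
    using separate_compact_compact[of A B] by blast
  have "closed B'"
    unfolding B'_def using compact_AB(2) compact_funpow_image[OF assms(1) hD(2,3)]
    by (intro closed_Un closed_UN) (auto intro: compact_imp_closed)
  moreover have "A \<inter> B' = {}"
    using disj by (fastforce simp: A_def B'_def B_def)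
  moreover have "A \<noteq> {}" "B \<noteq> {}"
  proof -
    obtain u v where "u \<in> \<Gamma>" "\<pi> u = (\<lambda>_. True)" "v \<in> \<Gamma>" "\<pi> v = (\<lambda>_. False)"
      using hD(5) by (metis UNIV_I imageE)
    then show "A \<noteq> {}" "B \<noteq> {}"
      by (auto simp: A_def B_def)
  qed
  then have "A \<noteq> {}" "B' \<noteq> {}"
    by (auto simp: B'_def)
  ultimately obtain \<phi> :: "'a \<Rightarrow> real" where \<phi>: "continuous_on UNIV \<phi>"
    "\<forall>z\<in>A. \<phi> z = 1" "\<forall>z\<in>B'. \<phi> z = 0"
    using metric_separation[OF compact_imp_closed[OF compact_AB(1)], of B'] by blast

  \<comment> \<open>Correlation of the coded points with the weight\<close>
  have "x e \<in> weighted_set \<theta> f X" for e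
  proof -
    define S where "S M = (\<Sum>n<M. \<theta> n * \<phi> ((f ^^ n) (x e)))" for M
    define E where "E M = {n. n < M \<and> n mod K = j \<and> R dvd n div K}" for M
    \<comment> \<open>At a free time the loss \<open>C\<close> covers both values of the symbol. At
      the other times of the class the symbol selects exactly the positive part of
      \<open>\<sigma> * \<theta> n\<close>, and outside the class both sides are 0.\<close>
    have pointwise: "(if n mod K = j then max 0 (\<sigma> * \<theta> n) else 0) - (if n mod K = j \<and> R dvd n div K then C else 0)
        \<le> \<sigma> * (\<theta> n * \<phi> ((f ^^ n) (x e)))" for n
    proof (cases "n mod K = j")
      case True
      then have n: "K * (n div K) + j = n"
        using mult_div_mod_eq[of K n] by simp
      have "\<phi> ((f ^^ n) (x e)) = (if s e (n div K + 1) then 1 else 0)"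
        using on[OF True] \<phi>(2,3) by (auto simp: A_def B_def B'_def)
      then show ?thesis
        using True C(2)[of n] \<sigma> by (auto simp: s_def n)
    next
      case False
      with off[OF False, of e] have "(f ^^ n) (x e) \<in> B'"
        by (auto simp: B'_def)
      with False show ?thesis
        using \<phi>(3) by simp
    qed
    \<comment> \<open>The term \<open>C / real R\<close> comes from the density of the free times
      and \<open>C / real M\<close> from the additive 1 in their count.\<close>
    have lower: "b M - C / real R - C / real M \<le> 1 / real M * \<bar>S M\<bar>" if "M > 0" for M
    proof -
      have "(\<Sum>n<M. if n mod K = j \<and> R dvd n div K then C else 0) = C * real (card (E M))"
        by (simp add: sum.If_cases E_def Int_def conj_commute)
      also have "\<dots> \<le> C * (real M / real R + 1)"
        unfolding E_def using C(1) card_sparse_residue[OF hD(1) \<open>R > 0\<close>] by (intro mult_left_mono) auto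
      finally have "real M * b M - C * (real M / real R + 1)
          \<le> (\<Sum>n<M. if n mod K = j then max 0 (\<sigma> * \<theta> n) else 0) -
            (\<Sum>n<M. if n mod K = j \<and> R dvd n div K then C else 0)"
        using that by (simp add: b_def)
      also have "\<dots> \<le> \<sigma> * S M"
        unfolding S_def sum_distrib_left sum_subtractf[symmetric] by (intro sum_mono pointwise)
      also have "\<dots> \<le> \<bar>S M\<bar>"
        using \<sigma> by auto
      finally have "1 / real M * (real M * b M - C * (real M / real R + 1)) \<le> 1 / real M * \<bar>S M\<bar>"
        by (intro mult_left_mono) auto
      moreover have "1 / real M * (real M * b M - C * (real M / real R + 1)) = b M - C / real R - C / real M"
        using that \<open>R > 0\<close> by (simp add: field_simps)
      ultimately show ?thesis
        by simp
    qed
    have "\<not> (\<lambda>M. 1 / real M * \<bar>S M\<bar>) \<longlonglongrightarrow> 0"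
    proof
      assume "(\<lambda>M. 1 / real M * \<bar>S M\<bar>) \<longlonglongrightarrow> 0"
      moreover have "(\<lambda>M. C / real M) \<longlonglongrightarrow> 0"
        by (rule lim_const_over_n)
      ultimately have "(\<lambda>M. 1 / real M * \<bar>S M\<bar> + C / real M) \<longlonglongrightarrow> 0 + 0"
        by (rule tendsto_add)
      then have "\<forall>\<^sub>F M in sequentially. 1 / real M * \<bar>S M\<bar> + C / real M < \<delta> / 2"
        using \<delta>(1) by (intro order_tendstoD(2)) auto
      then obtain M0 where M0: "\<And>M. M \<ge> M0 \<Longrightarrow> 1 / real M * \<bar>S M\<bar> + C / real M < \<delta> / 2"
        by (auto simp: eventually_sequentially)
      obtain M where M: "M \<ge> max M0 1" "b M \<ge> \<delta>"
        using \<delta>(2) by blast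
      then have "M \<ge> M0" "M > 0"
        by auto
      from M0[OF this(1)] lower[OF this(2)] R' M(2) show False
        by linarith
    qed
    then have "limsup (\<lambda>M. ereal (1 / real M * \<bar>S M\<bar>)) > 0"
      by (subst limsup_pos_iff) auto
    moreover have "continuous_on X \<phi>"
      using \<phi>(1) by (rule continuous_on_subset) simp
    ultimately show ?thesis
      using x_X unfolding weighted_set_def S_def by blast
  qed
  \<comment> \<open>At time \<open>K * R * m + j\<close> the symbol read is the free bit
    \<open>e m\<close>, so different bits put one point in \<open>A\<close> and the other in
    \<open>B\<close>. In the coding lemma the radius is half of the separation \<open>d\<close>,
    while its offset \<open>d\<close> is \<open>j\<close>.\<close>
  moreover have "2 * (d / 2) \<le> dist ((f ^^ (K * R * m + j)) (x e)) ((f ^^ (K * R * m + j)) (x e'))"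
    if "e m \<noteq> e' m" for e e' m
  proof -
    let ?n = "K * R * m + j"
    have n: "?n mod K = j" "?n div K = R * m"
      using j hD(1) by (simp_all add: mult.assoc)
    have "(f ^^ ?n) (x e'') \<in> \<Gamma> \<and> \<pi> ((f ^^ ?n) (x e'')) 0 = e'' m" for e''
      using on[OF n(1), of e''] \<open>R > 0\<close> by (simp add: n(2) s_def)
    then have "(f ^^ ?n) (x e'') \<in> (if e'' m then A else B)" for e''
      by (simp add: A_def B_def)
    moreover have "\<forall>u\<in>B. \<forall>v\<in>A. d \<le> dist u v"
      using d(2) by (metis dist_commute)
    ultimately show ?thesis
      using that d(2) by (cases "e m"; cases "e' m") (simp_all, metis+)
  qed
  ultimately show ?thesis
    using d(1) hD(1) \<open>R > 0\<close>
    by (intro htop_pos_if_coding[where y = x and r = "d / 2" and L = "K * R" and d = j]) auto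
qed

end
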